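(* Let $\mathbb{F}$ be $\mathbb{R}$ or $\mathbb{C}$, $N\ge 2$, $\mathbf{n}=(n_1,\dots,n_N)\in\mathbb{N}^N$, $0\le d\le \min_k n_k$, and let $\mathbf{p}=(p^{(1)},\dots,p^{(N)})$ with $p^{(k)}\in\mathcal{P}_{n_k}$. Put $$K=(N-1)(n_1-d+1)+\sum_{k=2}^N n_k,\qquad L=\sum_{k=1}^N(n_k-d+1),$$ $\ell_k:=n_k-d$ for $k=1,\dots,N$, $\ell_0:=K-n_1-1$, and $$q^{(1)}:=\mathrm{col}(\mathbf{0}_{\ell_0},p^{(1)},\mathbf{0}_{\ell_0}),\qquad q^{(2)}:=\mathrm{col}(\mathbf{0}_{\ell_1},p^{(2)},\mathbf{0}_{\ell_1},p^{(3)},\dots,\mathbf{0}_{\ell_1},p^{(N)},\mathbf{0}_{\ell_1}).$$ Then the generalized Sylvester subresultant matrix $\mathcal{S}_d(\mathbf{p})\in\mathbb{F}^{K\times L}$ satisfies $$\mathcal{S}_d(\mathbf{p})=\mathscr{H}_{K,\mathbf{l}}\big(\mathrm{col}(q^{(1)},q^{(2)})\big)\,\Phi,$$ where $\mathbf{l}:=[\,\ell_0+1\;\;\ell_1+1\,]^\top$ and $$\Phi:=\mathrm{blkdiag}\left(\begin{bmatrix}-I_{\ell_N+1}\\ \mathbf{0}_{n_1\times(\ell_N+1)}\end{bmatrix},\dots,\begin{bmatrix}-I_{\ell_3+1}\\ \mathbf{0}_{n_1\times(\ell_3+1)}\end{bmatrix},-I_{\ell_2+1},\,I_{\ell_1+1}\right)J_L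 .$$
   Context: $\mathcal{P}_n$ denotes the space of polynomials $p_0+p_1z+\dots+p_nz^n$ over $\mathbb{F}$ of degree at most $n$ (the leading coefficient may vanish), identified with coefficient vectors $[p_0\,\cdots\,p_n]^\top\in\mathbb{F}^{n+1}$. For $h\in\mathcal{P}_r$ and $m\ge0$, the multiplication matrix $\mathbf{M}_m(h)\in\mathbb{F}^{(m+r+1)\times(m+1)}$ is the lower banded Toeplitz matrix with $(i,j)$ entry $h_{i-j}$ (zero if $i-j\notin\{0,\dots,r\}$), so that $\mathbf{M}_m(h)q=h\cdot q$ for $q\in\mathcal{P}_m$. The generalized Sylvester subresultant matrix is the $K\times L$ matrix $$\mathcal{S}_d(\mathbf{p})=\begin{bmatrix}\mathbf{M}_{n_1-d}(p^{(2)}) & -\mathbf{M}_{n_2-d}(p^{(1)}) & & 0\\ \vdots & & \ddots & \\ \mathbf{M}_{n_1-d}(p^{(N)}) & 0 & & -\mathbf{M}_{n_N-d}(p^{(1)})\end{bmatrix},$$ i.e. it has $N-1$ block rows indexed by $k=2,\dots,N$ and $N$ block columns; block row $k$ has $\mathbf{M}_{n_1-d}(p^{(k)})$ in block column 1, $-\mathbf{M}_{n_k-d}(p^{(1)})$ in block column $k$, and zeros elsewhere. For $c\in\mathbb{F}^{k+l-1}$, $\mathscr{H}_{k,l}(c)\in\mathbb{F}^{k\times l}$ is the Hankel matrix with $(i,j)$ entry $c_{i+j-1}$. For $\mathbf{l}=[l_1\;l_2]^\top$ and $c^{(j)}\in\mathbb{F}^{K+l_j-1}$, $\mathscr{H}_{K,\mathbf{l}}(\mathrm{col}(c^{(1)},c^{(2)}))=[\mathscr{H}_{K,l_1}(c^{(1)})\;\;\mathscr{H}_{K,l_2}(c^{(2)})]$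 (a mosaic Hankel matrix with one block row). $\mathrm{col}$ stacks vectors vertically, $\mathbf{0}_m$ is the zero vector of length $m$, $\mathbf{0}_{a\times b}$ the zero matrix, $I_m$ the identity, $\mathrm{blkdiag}$ the block diagonal matrix with the given (rectangular) blocks, and $J_L$ the $L\times L$ exchange (reversal) matrix with ones on the antidiagonal. For $N=2$ the block diagonal part of $\Phi$ is $\mathrm{blkdiag}(-I_{\ell_2+1},I_{\ell_1+1})$. *)

theory Defs
  imports
    Complex_Main
    "HOL-Computational_Algebra.Polynomial"
    "Jordan_Normal_Form.Matrix"
begin

text \<open>
  The ground field, which is the field of real or of complex numbers, is modelled by a type of class
  \<^class>\<open>real_normed_field\<close>: both \<^typ>\<open>real\<close> and \<^typ>\<open>complex\<close> are instances, and by the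
  Gelfand--Mazur theorem every type of this class is isomorphic, as a real algebra, to one of the two.

  Matrix and vector indices start at 0 (the convention of the matrix library), while the polynomials
  and their degree bounds are indexed by \<open>1, \<dots>, N\<close>.
\<close>

text \<open>\<open>poly_space n\<close> is the space of polynomials of degree at most \<open>n\<close>; its elements are identified
  with vectors of length \<open>n + 1\<close> by \<open>coeff_vec n\<close>.\<close>

definition poly_space :: "nat \<Rightarrow> 'a :: zero poly set" where
  "poly_space n = {h. degree h \<le> n}"

definition coeff_vec :: "nat \<Rightarrow> 'a :: zero poly \<Rightarrow> 'a vec" where
  "coeff_vec n h = vec (n + 1) (coeff h)"

text \<open>The matrix of \<open>q \<mapsto> h * q\<close> from \<open>poly_space m\<close> to \<open>poly_space (m + r)\<close>, for
  \<open>h \<in> poly_space r\<close>. The bound \<open>r\<close> is an argument because it is not determined by \<open>h\<close>.\<close>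

definition mult_mat :: "nat \<Rightarrow> nat \<Rightarrow> 'a :: zero poly \<Rightarrow> 'a mat" where
  "mult_mat r m h = mat (m + r + 1) (m + 1)
     (\<lambda>(i, j). if j \<le> i \<and> i - j \<le> r then coeff h (i - j) else 0)"

lemma mult_mat_mult_coeff_vec:
  fixes h q :: "'a :: comm_ring_1 poly"
  assumes "h \<in> poly_space r" "q \<in> poly_space m"
  shows "mult_mat r m h *\<^sub>v coeff_vec m q = coeff_vec (m + r) (h * q)"
proof (rule eq_vecI)
  fix i assume "i < dim_vec (coeff_vec (m + r) (h * q))"
  then have i: "i < m + r + 1" by (simp add: coeff_vec_def)
  have "(mult_mat r m h *\<^sub>v coeff_vec m q) $ i
      = (\<Sum>j = 0..<m + 1. (if j \<le> i \<and> i - j \<le> r then coeff h (i - j) else 0) * coeff q j)"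
    using i by (simp add: mult_mat_def coeff_vec_def scalar_prod_def)
  also have "\<dots> = (\<Sum>j = 0..<m + 1. if j \<le> i then coeff q j * coeff h (i - j) else 0)"
    using assms(1) by (intro sum.cong) (auto simp: poly_space_def coeff_eq_0 mult.commute)
  also have "\<dots> = (\<Sum>j\<in>{j \<in> {0..<m + 1}. j \<le> i}. coeff q j * coeff h (i - j))"
    by (subst sum.inter_filter) auto
  also have "\<dots> = (\<Sum>j\<le>i. coeff q j * coeff h (i - j))"
    using assms(2) by (intro sum.mono_neutral_left)
      (auto simp: poly_space_def less_Suc_eq_le, metis le_degree le_trans mult_zero_left)
  also have "\<dots> = coeff (h * q) i"
    by (simp add: coeff_mult mult.commute[of h q])
  finally show "(mult_mat r m h *\<^sub>v coeff_vec m q) $ i = coeff_vec (m + r) (h * q) $ i"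
    using i by (simp add: coeff_vec_def)
qed (simp add: mult_mat_def coeff_vec_def)

definition append_cols :: "'a :: zero mat \<Rightarrow> 'a mat \<Rightarrow> 'a mat" (infixr \<open>@\<^sub>c\<close> 65) where
  "A @\<^sub>c B = four_block_mat A B (0\<^sub>m 0 (dim_col A)) (0\<^sub>m 0 (dim_col B))"

lemma carrier_append_cols [simp, intro]:
  "A \<in> carrier_mat nr nc1 \<Longrightarrow> B \<in> carrier_mat nr nc2 \<Longrightarrow> A @\<^sub>c B \<in> carrier_mat nr (nc1 + nc2)"
  by (auto simp: append_cols_def)

text \<open>The block matrix given by the list of its block rows, each a list of blocks. The end value
  \<open>0\<^sub>m 0 0\<close> is harmless: \<open>@\<^sub>r\<close> and \<open>@\<^sub>c\<close> take the number of columns, respectively of rows, from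
  their left argument.\<close>

definition block_mat :: "'a :: zero mat list list \<Rightarrow> 'a mat" where
  "block_mat Rs = foldr (@\<^sub>r) (map (\<lambda>R. foldr (@\<^sub>c) R (0\<^sub>m 0 0)) Rs) (0\<^sub>m 0 0)"

definition sylvester_subres_mat ::
  "nat \<Rightarrow> (nat \<Rightarrow> nat) \<Rightarrow> nat \<Rightarrow> (nat \<Rightarrow> 'a :: ab_group_add poly) \<Rightarrow> 'a mat" where
  "sylvester_subres_mat N n d p =
     block_mat (map (\<lambda>k. map (\<lambda>j.
         if j = 1 then mult_mat (n k) (n 1 - d) (p k)
         else if j = k then - mult_mat (n 1) (n k - d) (p 1)
         else 0\<^sub>m (n 1 - d + n k + 1) (n j - d + 1)) [1..<N + 1]) [2..<N + 1])"

text \<open>The \<open>k \<times> l\<close> Hankel matrix of a vector of length \<open>k + l - 1\<close>. In \<open>mosaic_hankel_mat\<close> the two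
  vectors are given stacked as a single vector, of length \<open>(k + l1 - 1) + (k + l2 - 1)\<close>.\<close>

definition hankel_mat :: "nat \<Rightarrow> nat \<Rightarrow> 'a vec \<Rightarrow> 'a mat" where
  "hankel_mat k l c = mat k l (\<lambda>(i, j). c $ (i + j))"

definition mosaic_hankel_mat :: "nat \<Rightarrow> nat \<times> nat \<Rightarrow> 'a :: zero vec \<Rightarrow> 'a mat" where
  "mosaic_hankel_mat k l c =
     hankel_mat k (fst l) (vec_first c (k + fst l - 1)) @\<^sub>c
     hankel_mat k (snd l) (vec_last c (k + snd l - 1))"

text \<open>The vertical concatenation of vectors (the library uses the name \<open>col\<close> for columns of a matrix).\<close>

definition stack_vec :: "'a :: zero vec list \<Rightarrow> 'a vec" where
  "stack_vec vs = foldr (@\<^sub>v) vs (0\<^sub>v 0)"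

definition exchange_mat :: "nat \<Rightarrow> 'a :: zero_neq_one mat" where
  "exchange_mat m = mat m m (\<lambda>(i, j). if i + j + 1 = m then 1 else 0)"

end

theory Submission
  imports Defs
begin

text \<open>
  Every block of the Sylvester subresultant matrix is a banded Toeplitz matrix, and reversing the
  order of the columns of a Toeplitz matrix gives a Hankel matrix. This is the role of the exchange
  matrix in \<open>\<Phi>\<close>. What remains is that the Hankel matrices of the different blocks are submatrices of
  just two large ones.

  Let \<open>R k\<close> be the index of the first row of block row \<open>k\<close>, so that \<open>R (k + 1) = R k + n 1 + ell k + 1\<close>
  and also \<open>R (k + 1) = R k + ell 1 + n k + 1\<close>, because \<open>ell k = n k - d\<close>.

  \<^item> Block column \<open>1\<close>, reversed, is the Hankel matrix of \<open>q2\<close>. The second form of the recurrence says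
    that \<open>R k\<close> is also the index in \<open>q2\<close> at which the zeros in front of \<open>p k\<close> start. The rows of
    block \<open>k\<close> therefore only read \<open>p k\<close> and the \<open>ell 1\<close> zeros on either side of it, which is what the
    band of the multiplication matrix by \<open>p k\<close> consists of.

  \<^item> Block column \<open>k > 1\<close> consists of a single band, \<open>- p 1\<close> in block row \<open>k\<close>, and of zeros. Its column
    \<open>y\<close> is \<open>- p 1\<close> shifted down by \<open>R k + y\<close>, hence is, up to sign, the window of length \<open>K\<close> of \<open>q1\<close> that
    starts at \<open>ell 0 - (R k + y)\<close>. By the first form of the recurrence these starting points, for the
    \<open>ell k + 1\<close> values of \<open>y\<close>, form an interval, and the intervals that belong to consecutive \<open>k\<close> are
    separated by a gap of length \<open>n 1\<close>. The blocks of zero rows in \<open>\<Phi>\<close> discard the windows in these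
    gaps.

  The proof compares entries. Each column of \<open>\<Phi>\<close> is plus or minus a unit vector, so that an entry of
  the product is, up to sign, a single entry of the mosaic Hankel matrix
  (\<open>mult_exchange_mat_index\<close>, \<open>mult_diag_block_mat_index\<close>). The entries of the two sides are then read
  off by \<open>sylvester_subres_mat_carrier_index\<close>, \<open>mosaic_hankel_mat_index\<close> and \<open>interlaced_index\<close>.
\<close>

section \<open>Entries of stacked vectors and matrices\<close>

lemma stack_vec_simps [simp]:
  "stack_vec [] = 0\<^sub>v 0"
  "stack_vec (v # vs) = v @\<^sub>v stack_vec vs"
  by (simp_all add: stack_vec_def)

lemma dim_foldr_append_cols:
  assumes "\<forall>A\<in>set As. dim_row A = r"
  shows "dim_row (foldr (@\<^sub>c) As (0\<^sub>m 0 0)) = (if As = [] then 0 else r)"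
    and "dim_col (foldr (@\<^sub>c) As (0\<^sub>m 0 0)) = sum_list (map dim_col As)"
  using assms by (induction As) (auto simp: append_cols_def)

text \<open>Singling out a block by a decomposition \<open>As @ A # Bs\<close> of the list gives its offset as a sum over
  the prefix \<open>As\<close>, which for a family indexed by an interval is again a sum over an interval.\<close>

lemma foldr_append_cols_index:
  assumes "\<forall>M\<in>set (As @ A # Bs). dim_row M = r" and "i < r" and "j < dim_col A"
  shows "foldr (@\<^sub>c) (As @ A # Bs) (0\<^sub>m 0 0) $$ (i, sum_list (map dim_col As) + j) = A $$ (i, j)"
  using assms
proof (induction As)
  case Nil
  then show ?case
    by (simp add: append_cols_def)
next
  case (Cons B As)
  define M where "M = foldr (@\<^sub>c) (As @ A # Bs) (0\<^sub>m 0 0)"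
  have "dim_col M = sum_list (map dim_col (As @ A # Bs))"
    unfolding M_def by (rule dim_foldr_append_cols) (use Cons.prems in auto)
  moreover have "M $$ (i, sum_list (map dim_col As) + j) = A $$ (i, j)"
    using Cons by (simp add: M_def)
  ultimately show ?case
    using Cons.prems
    by (simp del: foldr_append add: M_def[symmetric]) (simp add: append_cols_def add.assoc)
qed

lemma dim_foldr_append_rows:
  assumes "\<forall>A\<in>set As. dim_col A = c"
  shows "dim_row (foldr (@\<^sub>r) As (0\<^sub>m 0 0)) = sum_list (map dim_row As)"
    and "dim_col (foldr (@\<^sub>r) As (0\<^sub>m 0 0)) = (if As = [] then 0 else c)"
  using assms by (induction As) (auto simp: append_rows_def)

lemma foldr_append_rows_index:
  assumes "\<forall>M\<in>set (As @ A # Bs). dim_col M = c" and "i < dim_row A" and "j < c"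
  shows "foldr (@\<^sub>r) (As @ A # Bs) (0\<^sub>m 0 0) $$ (sum_list (map dim_row As) + i, j) = A $$ (i, j)"
  using assms
proof (induction As)
  case Nil
  then show ?case
    by (simp add: append_rows_def)
next
  case (Cons B As)
  define M where "M = foldr (@\<^sub>r) (As @ A # Bs) (0\<^sub>m 0 0)"
  have "dim_row M = sum_list (map dim_row (As @ A # Bs))"
    unfolding M_def by (rule dim_foldr_append_rows) (use Cons.prems in auto)
  moreover have "M $$ (sum_list (map dim_row As) + i, j) = A $$ (i, j)"
    using Cons by (simp add: M_def)
  ultimately show ?case
    using Cons.prems
    by (simp del: foldr_append add: M_def[symmetric]) (simp add: append_rows_def add.assoc)
qed

lemma index_in_block:
  fixes f :: "nat \<Rightarrow> nat"
  assumes "i < sum f {a..<b}"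
  obtains k x where "a \<le> k" "k < b" "x < f k" "i = sum f {a..<k} + x"
  using assms
proof (induction b arbitrary: thesis)
  case 0
  then show ?case by simp
next
  case (Suc b)
  show ?case
  proof (cases "i < sum f {a..<b}")
    case True
    then show ?thesis
      using Suc.IH[OF _ True] Suc.prems(1) by (metis less_SucI)
  next
    case False
    with Suc.prems(2) have "a \<le> b"
      by (auto split: if_splits)
    with False Suc.prems show ?thesis
      by (intro Suc.prems(1)[of b "i - sum f {a..<b}"]) auto
  qed
qed

lemma sum_list_upt: "sum_list (map f [a..<b]) = sum f {a..<b :: nat}"
  by (simp add: interv_sum_list_conv_sum_set_nat)

lemma upt_split: "a \<le> k \<Longrightarrow> k < b \<Longrightarrow> [a..<b] = [a..<k] @ k # [Suc k..<b]"
  by (metis upt_conv_Cons upt_add_eq_append less_imp_le le_Suc_ex)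

section \<open>Columns of the factor \<Phi>\<close>

lemma mult_exchange_mat_index:
  fixes A :: "'a :: semiring_1 mat"
  assumes "dim_col A = m" and "i < dim_row A" and "j < m"
  shows "(A * exchange_mat m) $$ (i, j) = A $$ (i, m - 1 - j)"
proof -
  have "(A * exchange_mat m) $$ (i, j) = (\<Sum>k = 0..<m. A $$ (i, k) * (if k + j + 1 = m then 1 else 0))"
    using assms by (simp add: exchange_mat_def scalar_prod_def)
  also have "\<dots> = (\<Sum>k = 0..<m. if k = m - 1 - j then A $$ (i, k) else 0)"
    using assms(3) by (intro sum.cong) auto
  also have "\<dots> = A $$ (i, m - 1 - j)"
    using assms(3) by simp
  finally show ?thesis .
qed

text \<open>A column of a block diagonal matrix that runs through a block with a multiple of a unit vector in
  that column is a multiple of a unit vector itself. Only this column of the block is constrained, so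
  that the rectangular blocks of \<open>\<Phi>\<close>, with their additional zero rows, and the identity blocks are
  covered by one statement.\<close>

lemma diag_block_mat_column:
  fixes A :: "'a :: zero mat"
  assumes "j < dim_col A" and "r < dim_row A"
    and "\<And>x. x < dim_row A \<Longrightarrow> A $$ (x, j) = (if x = r then s else 0)"
    and "x < sum_list (map dim_row (As @ A # Bs))"
  shows "diag_block_mat (As @ A # Bs) $$ (x, sum_list (map dim_col As) + j)
    = (if x = sum_list (map dim_row As) + r then s else 0)"
  using assms(4)
proof (induction As arbitrary: x)
  case Nil
  then show ?case
    using assms(1-3) by (auto simp: Let_def dim_diag_block_mat)
next
  case (Cons B As)
  have "diag_block_mat (As @ A # Bs) $$ (x - dim_row B, sum_list (map dim_col As) + j)
    = (if x - dim_row B = sum_list (map dim_row As) + r then s else 0)" if "\<not> x < dim_row B"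
    using Cons that by auto
  then show ?case
    using Cons.prems assms(1,2) by (auto simp: Let_def dim_diag_block_mat)
qed

lemma mult_diag_block_mat_index:
  fixes A M :: "'a :: semiring_1 mat"
  assumes "j < dim_col A" and "r < dim_row A"
    and "\<And>x. x < dim_row A \<Longrightarrow> A $$ (x, j) = (if x = r then s else 0)"
    and "dim_col M = sum_list (map dim_row (As @ A # Bs))" and "i < dim_row M"
  shows "(M * diag_block_mat (As @ A # Bs)) $$ (i, sum_list (map dim_col As) + j)
    = M $$ (i, sum_list (map dim_row As) + r) * s"
proof -
  let ?r = "sum_list (map dim_row As) + r" and ?c = "sum_list (map dim_col As) + j"
  let ?D = "diag_block_mat (As @ A # Bs)"
  have dims: "dim_row ?D = dim_col M" "?c < dim_col ?D"
    using assms(1,4) by (auto simp: dim_diag_block_mat)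
  have "(M * ?D) $$ (i, ?c) = (\<Sum>x = 0..<dim_col M. M $$ (i, x) * ?D $$ (x, ?c))"
    using assms(5) dims by (simp add: scalar_prod_def)
  also have "\<dots> = (\<Sum>x = 0..<dim_col M. if x = ?r then M $$ (i, x) * s else 0)"
    using diag_block_mat_column[OF assms(1-3)] assms(4) by (intro sum.cong) auto
  also have "\<dots> = M $$ (i, ?r) * s"
    using assms(2,4) by simp
  finally show ?thesis .
qed

section \<open>Entries of the Sylvester and Hankel matrices\<close>

text \<open>The bound \<open>d \<le> n k\<close> makes the truncated subtractions exact: without it, the blocks of block row
  \<open>k\<close>, with \<open>n 1 - d + n k + 1\<close> and \<open>n k - d + n 1 + 1\<close> rows, need not have the same height.\<close>

lemma sylvester_subres_mat_carrier_index:
  fixes n :: "nat \<Rightarrow> nat" and p :: "nat \<Rightarrow> 'a :: ab_group_add poly"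
  assumes "N \<ge> 2" and d: "\<And>k. k \<in> {1..N} \<Longrightarrow> d \<le> n k"
  defines "h \<equiv> \<lambda>k. n 1 - d + n k + 1" and "w \<equiv> \<lambda>j. n j - d + 1"
  shows "sylvester_subres_mat N n d p \<in> carrier_mat (sum h {2..<N + 1}) (sum w {1..<N + 1})"
    and "\<lbrakk>k \<in> {2..N}; j \<in> {1..N}; x < h k; y < w j\<rbrakk> \<Longrightarrow>
      sylvester_subres_mat N n d p $$ (sum h {2..<k} + x, sum w {1..<j} + y) =
        (if j = 1 then if y \<le> x \<and> x - y \<le> n k then coeff (p k) (x - y) else 0
         else if j = k then if y \<le> x \<and> x - y \<le> n 1 then - coeff (p 1) (x - y) else 0
         else 0)"
proof -
  define blk where "blk k j =
    (if j = 1 then mult_mat (n k) (n 1 - d) (p k)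
     else if j = k then - mult_mat (n 1) (n k - d) (p 1)
     else 0\<^sub>m (n 1 - d + n k + 1) (n j - d + 1))" for k j
  define row where "row k = foldr (@\<^sub>c) (map (blk k) [1..<N + 1]) (0\<^sub>m 0 0)" for k
  have S: "sylvester_subres_mat N n d p = foldr (@\<^sub>r) (map row [2..<N + 1]) (0\<^sub>m 0 0)"
    unfolding sylvester_subres_mat_def block_mat_def map_map comp_def row_def[abs_def] blk_def[abs_def] ..
  have blk: "dim_row (blk k j) = h k" "dim_col (blk k j) = w j" if "k \<in> {2..N}" for k j
    using d[of 1] d[of k] that \<open>N \<ge> 2\<close> by (auto simp: blk_def h_def w_def mult_mat_def)
  have row: "dim_row (row k) = h k" "dim_col (row k) = sum w {1..<N + 1}" if k: "k \<in> {2..N}" for k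
  proof -
    have "\<forall>A\<in>set (map (blk k) [1..<N + 1]). dim_row A = h k"
      using blk(1)[OF k] by auto
    note * = dim_foldr_append_cols[OF this, folded row_def]
    show "dim_row (row k) = h k"
      using *(1) \<open>N \<ge> 2\<close> by (simp del: upt_Suc)
    show "dim_col (row k) = sum w {1..<N + 1}"
      using *(2) by (simp add: comp_def blk(2)[OF k] sum_list_upt del: upt_Suc)
  qed
  have map_row: "map dim_row (map row [2..<k]) = map h [2..<k]" if "k \<le> N + 1" for k
    using that by (auto simp: row(1))
  have cols: "\<forall>A\<in>set (map row [2..<N + 1]). dim_col A = sum w {1..<N + 1}"
    by (auto simp: row(2) simp del: upt_Suc sum.op_ivl_Suc)
  show "sylvester_subres_mat N n d p \<in> carrier_mat (sum h {2..<N + 1}) (sum w {1..<N + 1})"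
  proof (rule carrier_matI)
    show "dim_row (sylvester_subres_mat N n d p) = sum h {2..<N + 1}"
      by (simp only: S dim_foldr_append_rows(1)[OF cols] map_row[OF order_refl] sum_list_upt)
    have "map row [2..<N + 1] \<noteq> []"
      using \<open>N \<ge> 2\<close> by simp
    then show "dim_col (sylvester_subres_mat N n d p) = sum w {1..<N + 1}"
      by (simp only: S dim_foldr_append_rows(2)[OF cols] if_False)
  qed
  assume k: "k \<in> {2..N}" and j: "j \<in> {1..N}" and x: "x < h k" and y: "y < w j"
  have sp: "map row [2..<N + 1] = map row [2..<k] @ row k # map row [Suc k..<N + 1]"
    using k upt_split[of 2 k "N + 1"] by (simp del: upt_Suc)
  have sc: "map (blk k) [1..<N + 1]
      = map (blk k) [1..<j] @ blk k j # map (blk k) [Suc j..<N + 1]"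
    using j upt_split[of 1 j "N + 1"] by (simp del: upt_Suc)
  have yN: "sum w {1..<j} + y < sum w {1..<N + 1}"
  proof -
    have "sum w {1..<j} + y < sum w {1..<Suc j}"
      using j y by simp
    also have "\<dots> \<le> sum w {1..<N + 1}"
      using j by (intro sum_mono2) auto
    finally show ?thesis .
  qed
  have "sylvester_subres_mat N n d p $$ (sum h {2..<k} + x, sum w {1..<j} + y)
      = row k $$ (x, sum w {1..<j} + y)"
    using foldr_append_rows_index[OF cols[unfolded sp], of x "sum w {1..<j} + y"]
      x yN row(1)[OF k] map_row[of k] k
    unfolding S sp by (simp add: sum_list_upt del: upt_Suc sum.op_ivl_Suc map_map)
  also have "\<dots> = blk k j $$ (x, y)"
  proof -
    have "\<forall>A\<in>set (map (blk k) [1..<N + 1]). dim_row A = h k"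
      using blk(1)[OF k] by auto
    from foldr_append_cols_index[OF this[unfolded sc] x, of y]
    show ?thesis
      using y unfolding row_def sc
      by (simp add: comp_def blk(2)[OF k] sum_list_upt del: upt_Suc sum.op_ivl_Suc)
  qed
  also have "\<dots> = (if j = 1 then if y \<le> x \<and> x - y \<le> n k then coeff (p k) (x - y) else 0
         else if j = k then if y \<le> x \<and> x - y \<le> n 1 then - coeff (p 1) (x - y) else 0
         else 0)"
    using x y d[of 1] d[of k] k by (auto simp: blk_def mult_mat_def h_def w_def)
  finally show "sylvester_subres_mat N n d p $$ (sum h {2..<k} + x, sum w {1..<j} + y) =
        (if j = 1 then if y \<le> x \<and> x - y \<le> n k then coeff (p k) (x - y) else 0
         else if j = k then if y \<le> x \<and> x - y \<le> n 1 then - coeff (p 1) (x - y) else 0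
         else 0)" .
qed

text \<open>The tail \<open>v\<close> is left general because in \<open>q2\<close> the zeros behind a coefficient vector are followed by
  the coefficients of the next polynomial.\<close>

lemma padded_coeff_vec_index:
  assumes "x < a + n + 1 + dim_vec v" and "\<And>i. i < b \<Longrightarrow> v $ i = 0" and "x < a + n + 1 + b"
  shows "(0\<^sub>v a @\<^sub>v (coeff_vec n h @\<^sub>v v)) $ x
    = (if a \<le> x \<and> x \<le> a + n then coeff h (x - a) else 0)"
  using assms by (auto simp: coeff_vec_def)

lemma dim_interlaced:
  "dim_vec (stack_vec (concat (map (\<lambda>k. [0\<^sub>v m, coeff_vec (n k) (p k)]) ks) @ [0\<^sub>v m]))
    = sum_list (map (\<lambda>k. m + n k + 1) ks) + m"
  by (induction ks) (auto simp: coeff_vec_def)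

text \<open>The window that starts with the zeros in front of \<open>p k\<close> may extend over the zeros behind it as
  well, since every coefficient vector is followed by \<open>m\<close> zeros: either those in front of the next
  polynomial or the final ones.\<close>

lemma interlaced_index:
  fixes p :: "nat \<Rightarrow> 'a :: zero poly"
  assumes "x < m + n k + 1 + m"
  shows "stack_vec (concat (map (\<lambda>k. [0\<^sub>v m, coeff_vec (n k) (p k)]) (ks @ k # ks')) @ [0\<^sub>v m])
      $ (sum_list (map (\<lambda>k. m + n k + 1) ks) + x)
    = (if m \<le> x \<and> x \<le> m + n k then coeff (p k) (x - m) else 0)"
proof (induction ks)
  case Nil
  let ?v = "stack_vec (concat (map (\<lambda>k. [0\<^sub>v m, coeff_vec (n k) (p k)]) ks') @ [0\<^sub>v m])"
  have "?v $ i = 0" if "i < m" for i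
    using that by (cases ks') auto
  moreover have "dim_vec ?v \<ge> m"
    by (simp add: dim_interlaced)
  ultimately show ?case
    using padded_coeff_vec_index[of x m "n k" ?v m "p k"] assms by simp
next
  case (Cons l ks)
  let ?v = "stack_vec (concat (map (\<lambda>k. [0\<^sub>v m, coeff_vec (n k) (p k)]) (ks @ k # ks')) @ [0\<^sub>v m])"
  have "sum_list (map (\<lambda>k. m + n k + 1) ks) + x < dim_vec ?v"
    using assms unfolding dim_interlaced by simp
  then show ?case
    using Cons by (simp add: coeff_vec_def add.assoc)
qed

lemma mosaic_hankel_mat_index:
  assumes "dim_vec u = k + a - 1" and "dim_vec v = k + b - 1" and "i < k"
  shows "j < a \<Longrightarrow> mosaic_hankel_mat k (a, b) (stack_vec [u, v]) $$ (i, j) = u $ (i + j)"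
    and "j < b \<Longrightarrow> mosaic_hankel_mat k (a, b) (stack_vec [u, v]) $$ (i, a + j) = v $ (i + j)"
  using assms
  by (auto simp: mosaic_hankel_mat_def append_cols_def hankel_mat_def vec_first_def vec_last_def)

theorem proposition6p1:
  fixes N d K L :: nat
    and n ell :: "nat \<Rightarrow> nat"
    and p :: "nat \<Rightarrow> 'a :: real_normed_field poly"
    and q1 q2 :: "'a vec"
    and \<Phi> :: "'a mat"
  assumes "N \<ge> 2"
    and "\<And>k. k \<in> {1..N} \<Longrightarrow> d \<le> n k"
    and "\<And>k. k \<in> {1..N} \<Longrightarrow> p k \<in> poly_space (n k)"
    and "K = (N - 1) * (n 1 - d + 1) + (\<Sum>k = 2..N. n k)"
    and "L = (\<Sum>k = 1..N. (n k - d + 1))"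
    and "\<And>k. k \<in> {1..N} \<Longrightarrow> ell k = n k - d"
    and "ell 0 = K - n 1 - 1"
    and "q1 = stack_vec [0\<^sub>v (ell 0), coeff_vec (n 1) (p 1), 0\<^sub>v (ell 0)]"
    and "q2 = stack_vec (concat (map (\<lambda>k. [0\<^sub>v (ell 1), coeff_vec (n k) (p k)]) [2..<N + 1])
                @ [0\<^sub>v (ell 1)])"
    and "\<Phi> = diag_block_mat
               (map (\<lambda>k. (- 1\<^sub>m (ell k + 1)) @\<^sub>r 0\<^sub>m (n 1) (ell k + 1)) (rev [3..<N + 1])
                @ [- 1\<^sub>m (ell 2 + 1), 1\<^sub>m (ell 1 + 1)])
             * exchange_mat L"
  shows "sylvester_subres_mat N n d p \<in> carrier_mat K L \<and>
         sylvester_subres_mat N n d p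
           = mosaic_hankel_mat K (ell 0 + 1, ell 1 + 1) (stack_vec [q1, q2]) * \<Phi>"
proof -
  define h where "h = (\<lambda>k. n 1 - d + n k + 1)"
  define w where "w = (\<lambda>k. n k - d + 1)"
  define F :: "nat \<Rightarrow> 'a mat"
    where "F k = (- 1\<^sub>m (ell k + 1)) @\<^sub>r 0\<^sub>m (n 1) (ell k + 1)" for k
  define Ds where "Ds = map F (rev [3..<N + 1]) @ [- 1\<^sub>m (ell 2 + 1), 1\<^sub>m (ell 1 + 1)]"
  define M where "M = mosaic_hankel_mat K (ell 0 + 1, ell 1 + 1) (stack_vec [q1, q2])"
  note \<Phi> = assms(10)[folded F_def, folded Ds_def]
  have ell: "w k = ell k + 1" "n k = ell k + d" "h k = ell k + 1 + n 1" if "k \<in> {1..N}" for k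
    using assms(1,2,6) assms(2)[of 1] that by (auto simp: w_def h_def)
  have K: "K = sum h {2..<N + 1}"
  proof -
    have "sum h {2..<N + 1} = (\<Sum>k = 2..N. (n 1 - d + 1) + n k)"
      by (intro sum.cong) (auto simp: h_def)
    then show ?thesis
      unfolding assms(4) using \<open>N \<ge> 2\<close> by (simp only: sum.distrib) simp
  qed
  have L: "L = sum w {1..<N + 1}"
    unfolding assms(5) by (intro sum.cong) (auto simp: w_def)
  have K_split: "K = sum h {2..<k} + h k + sum h {Suc k..<N + 1}" if "k \<in> {2..N}" for k
    using that sum.atLeastLessThan_concat[of 2 k "N + 1" h] sum.atLeast_Suc_lessThan[of k "N + 1" h]
    by (simp add: K del: sum.op_ivl_Suc)
  have L_split: "L = sum w {1..<k} + w k + sum w {Suc k..<N + 1}" if "k \<in> {1..N}" for k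
    using that sum.atLeastLessThan_concat[of 1 k "N + 1" w] sum.atLeast_Suc_lessThan[of k "N + 1" w]
    by (simp add: L del: sum.op_ivl_Suc)
  \<comment> \<open>The truncated subtractions in \<open>ell 0 = K - n 1 - 1\<close> are exact, since block row \<open>2\<close> alone has at
    least \<open>n 1 + 1\<close> rows.\<close>
  have K0: "K = ell 0 + 1 + n 1"
    using K_split[of 2] ell(3)[of 2] assms(1,7) by simp
  have F: "dim_row (F k) = h k" "dim_col (F k) = w k" if "k \<in> {1..N}" for k
    using that by (simp_all add: F_def append_rows_def ell)
  have Fs: "sum_list (map dim_row (map F (rev [k..<N + 1]))) = sum h {k..<N + 1}"
    "sum_list (map dim_col (map F (rev [k..<N + 1]))) = sum w {k..<N + 1}" if "k \<ge> 1" for k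
  proof -
    have "map (dim_row \<circ> F) (rev [k..<N + 1]) = rev (map h [k..<N + 1])"
      "map (dim_col \<circ> F) (rev [k..<N + 1]) = rev (map w [k..<N + 1])"
      using that F by (auto simp: rev_map)
    then show "sum_list (map dim_row (map F (rev [k..<N + 1]))) = sum h {k..<N + 1}"
      "sum_list (map dim_col (map F (rev [k..<N + 1]))) = sum w {k..<N + 1}"
      by (simp_all add: sum_list_upt del: upt_Suc sum.op_ivl_Suc)
  qed
  have dims: "sum_list (map dim_row Ds) = ell 0 + 1 + (ell 1 + 1)" "sum_list (map dim_col Ds) = L"
    using Fs[of 3] K_split[of 2] L_split[of 1] sum.atLeast_Suc_lessThan[of 2 "N + 1" w]
      K0 ell[of 1] ell[of 2] \<open>N \<ge> 2\<close>
    by (simp_all add: Ds_def numeral_2_eq_2 numeral_3_eq_3 del: upt_Suc sum.op_ivl_Suc map_map)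
  have M_dims: "dim_row M = K" "dim_col M = ell 0 + 1 + (ell 1 + 1)"
    by (simp_all add: M_def mosaic_hankel_mat_def append_cols_def hankel_mat_def)
  have q1_dim: "dim_vec q1 = K + (ell 0 + 1) - 1"
    using K0 by (simp add: assms(8) coeff_vec_def)
  have h_eq: "h = (\<lambda>k. ell 1 + n k + 1)"
    using assms(6)[of 1] \<open>N \<ge> 2\<close> by (simp add: h_def)
  have q2_dim: "dim_vec q2 = K + (ell 1 + 1) - 1"
    unfolding assms(9) dim_interlaced sum_list_upt K h_eq by simp
  have q1_index: "q1 $ t = (if ell 0 \<le> t \<and> t \<le> ell 0 + n 1 then coeff (p 1) (t - ell 0) else 0)"
    if "t < K + ell 0" for t
    unfolding assms(8)
    using padded_coeff_vec_index[of t "ell 0" "n 1" "0\<^sub>v (ell 0) @\<^sub>v 0\<^sub>v 0" "ell 0" "p 1"] that K0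
    by auto
  have q2_index: "q2 $ (sum h {2..<k} + t)
      = (if ell 1 \<le> t \<and> t \<le> ell 1 + n k then coeff (p k) (t - ell 1) else 0)"
    if "k \<in> {2..N}" "t < h k + ell 1" for k t
    using interlaced_index[of t "ell 1" n k p "[2..<k]" "[Suc k..<N + 1]"] that
      upt_split[of 2 k "N + 1"]
    by (simp add: assms(9) h_eq sum_list_upt del: upt_Suc)
  note M_index = mosaic_hankel_mat_index[OF q1_dim q2_dim, folded M_def]
  have S_carrier: "sylvester_subres_mat N n d p \<in> carrier_mat K L"
    unfolding K L h_def w_def by (intro sylvester_subres_mat_carrier_index(1) assms(1,2))
  have S_index: "sylvester_subres_mat N n d p $$ (sum h {2..<k} + x, sum w {1..<j} + y) =
      (if j = 1 then if y \<le> x \<and> x - y \<le> n k then coeff (p k) (x - y) else 0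
       else if j = k then if y \<le> x \<and> x - y \<le> n 1 then - coeff (p 1) (x - y) else 0
       else 0)"
    if "k \<in> {2..N}" "j \<in> {1..N}" "x < h k" "y < w j" for k j x y
    unfolding h_def w_def
    by (intro sylvester_subres_mat_carrier_index(2) assms(1,2) that[unfolded h_def w_def])
  have "sylvester_subres_mat N n d p = M * \<Phi>"
  proof (rule eq_matI)
    show "dim_row (sylvester_subres_mat N n d p) = dim_row (M * \<Phi>)"
      "dim_col (sylvester_subres_mat N n d p) = dim_col (M * \<Phi>)"
      using S_carrier by (simp_all add: M_dims \<Phi> exchange_mat_def)
  next
    fix i c assume "i < dim_row (M * \<Phi>)" "c < dim_col (M * \<Phi>)"
    then have i: "i < K" and c: "c < L"
      by (simp_all add: M_dims \<Phi> exchange_mat_def)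
    obtain k x where k: "k \<in> {2..N}" and x: "x < h k" and ikx: "i = sum h {2..<k} + x"
      using index_in_block[OF i[unfolded K]] by (metis Suc_eq_plus1 atLeastAtMost_iff less_Suc_eq_le)
    obtain j y where j: "j \<in> {1..N}" and y: "y < w j" and cjy: "c = sum w {1..<j} + y"
      using index_in_block[OF c[unfolded L]] by (metis Suc_eq_plus1 atLeastAtMost_iff less_Suc_eq_le)
    \<comment> \<open>The exchange matrix reverses the columns: those of the blocks after \<open>j\<close> now come first, and
      column \<open>y\<close> of block \<open>j\<close> becomes column \<open>ell j - y\<close>.\<close>
    have c': "L - 1 - c = sum w {Suc j..<N + 1} + (ell j - y)"
      using L_split[OF j] y ell(1)[OF j] by (simp add: cjy del: sum.op_ivl_Suc)
    have D_dims: "dim_row (diag_block_mat Ds) = dim_col M" "dim_col (diag_block_mat Ds) = L"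
      using dims by (simp_all add: dim_diag_block_mat M_dims)
    have "(M * \<Phi>) $$ (i, c) = ((M * diag_block_mat Ds) * exchange_mat L) $$ (i, c)"
      unfolding \<Phi>
      by (subst assoc_mult_mat[of M K "dim_col M" _ L _ L])
        (auto simp: D_dims M_dims exchange_mat_def)
    also have "\<dots> = (M * diag_block_mat Ds) $$ (i, L - 1 - c)"
      using i c by (intro mult_exchange_mat_index) (simp_all add: D_dims M_dims)
    finally have MPhi: "(M * \<Phi>) $$ (i, c)
      = (M * diag_block_mat Ds) $$ (i, sum w {Suc j..<N + 1} + (ell j - y))"
      by (simp only: c')
    show "sylvester_subres_mat N n d p $$ (i, c) = (M * \<Phi>) $$ (i, c)"
    proof (cases "j = 1")
      case True
      define As where "As = map F (rev [3..<N + 1]) @ [- 1\<^sub>m (ell 2 + 1)]"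
      have Ds: "Ds = As @ 1\<^sub>m (ell 1 + 1) # []"
        by (simp add: Ds_def As_def)
      have As: "sum_list (map dim_row As) = ell 0 + 1"
        "sum_list (map dim_col As) = sum w {Suc j..<N + 1}"
        using dims L_split[OF j] ell(1)[OF j] True by (simp_all add: Ds)
      have "(M * \<Phi>) $$ (i, c) = M $$ (i, ell 0 + 1 + (ell j - y)) * 1"
        unfolding MPhi Ds As[symmetric]
        by (rule mult_diag_block_mat_index)
          (use i y ell(1)[OF j] dims(1) True in \<open>auto simp: Ds M_dims\<close>)
      also have "\<dots> = q2 $ (i + (ell 1 - y))"
        using True M_index(2)[OF i, of "ell 1 - y"] by simp
      also have "\<dots> = q2 $ (sum h {2..<k} + (x + (ell 1 - y)))"
        by (simp add: ikx add.assoc)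
      also have "\<dots> = (if y \<le> x \<and> x - y \<le> n k then coeff (p k) (x - y) else 0)"
        using x y ell(1)[OF j] True k by (subst q2_index) auto
      also have "\<dots> = sylvester_subres_mat N n d p $$ (i, c)"
        using True S_index[OF k j x y] unfolding ikx cjy by simp
      finally show ?thesis ..
    next
      case False
      then have j2: "j \<in> {2..N}"
        using j by simp
      \<comment> \<open>The block of \<open>\<Phi>\<close> for \<open>j = 2\<close> has no zero rows, unlike those for \<open>j > 2\<close>; all that matters is
        that it starts with a negative identity matrix and is zero below.\<close>
      obtain A Bs where Ds: "Ds = map F (rev [Suc j..<N + 1]) @ A # Bs"
        and A: "dim_col A = ell j + 1" "ell j + 1 \<le> dim_row A"
        "\<And>a b. a < dim_row A \<Longrightarrow> b < ell j + 1 \<Longrightarrow> A $$ (a, b) = (if a = b then - 1 else 0)"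
      proof (cases "j = 2")
        case True
        show ?thesis
          by (rule that[of "- 1\<^sub>m (ell 2 + 1)" "[1\<^sub>m (ell 1 + 1)]"])
            (auto simp: Ds_def True numeral_3_eq_3 numeral_2_eq_2)
      next
        case False
        with j2 have "rev [3..<N + 1] = rev [Suc j..<N + 1] @ j # rev [3..<j]"
          using upt_split[of 3 j "N + 1"] by (simp del: upt_Suc)
        then show ?thesis
          by (intro that[of "F j" "map F (rev [3..<j]) @ [- 1\<^sub>m (ell 2 + 1), 1\<^sub>m (ell 1 + 1)]"])
            (auto simp: Ds_def F_def append_rows_def simp del: upt_Suc)
      qed
      have Suc_j: "1 \<le> Suc j"
        by simp
      have t: "K = sum h {2..<j} + (ell j + 1 + n 1) + sum h {Suc j..<N + 1}"
        using K_split[OF j2] ell(3)[OF j] by simp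
      have "(M * \<Phi>) $$ (i, c) = M $$ (i, sum h {Suc j..<N + 1} + (ell j - y)) * - 1"
        unfolding MPhi Ds Fs(1,2)[OF Suc_j, symmetric]
        by (rule mult_diag_block_mat_index)
          (use i y ell(1)[OF j] dims(1) A in \<open>auto simp: Ds M_dims\<close>)
      also have "\<dots> = - q1 $ (i + (sum h {Suc j..<N + 1} + (ell j - y)))"
        using t K0 by (subst M_index(1)[OF i]) auto
      also have "\<dots> = (if sum h {2..<j} + y \<le> i \<and> i - (sum h {2..<j} + y) \<le> n 1
          then - coeff (p 1) (i - (sum h {2..<j} + y)) else 0)"
        using t K0 i y ell(1)[OF j] 
        by (subst q1_index) (auto simp: add.commute simp del: sum.op_ivl_Suc)
      also have "\<dots> = (if j = k then if y \<le> x \<and> x - y \<le> n 1 then - coeff (p 1) (x - y) else 0 else 0)"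
        \<comment> \<open>Off the diagonal the band is missed: a later block row starts at least \<open>ell j + 1 + n 1\<close>
          rows below the first row of block row \<open>j\<close>, whereas the band ends \<open>ell j + n 1\<close> rows below it; an
          earlier block row ends above it.\<close>
      proof (cases j k rule: linorder_cases)
        case less
        then have "sum h {2..<Suc j} \<le> sum h {2..<k}"
          by (intro sum_mono2) auto
        then show ?thesis
          using less j2 y ell(1,3)[OF j] by (auto simp: ikx)
      next
        case equal
        then show ?thesis by (simp add: ikx)
      next
        case greater
        then have "sum h {2..<Suc k} \<le> sum h {2..<j}"
          by (intro sum_mono2) auto
        then show ?thesis
          using greater k x by (auto simp: ikx)
      qed
      also have "\<dots> = sylvester_subres_mat N n d p $$ (i, c)"
        using False S_index[OF k j x y] unfolding ikx cjy by simp
      finally show ?thesis ..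
    qed
  qed
  with S_carrier show ?thesis
    by (simp add: M_def)
qed

end
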